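(* Let $a,b,c$ be real numbers with $(a,b)\neq(0,0)$ and $|c|\le 2\bigl||a|-|b|\bigr|$, and let $$P_{a,b,c}(x,y)=a\Bigl(x+\frac1x\Bigr)+b\Bigl(y+\frac1y\Bigr)+c .$$ Then $$\mathrm{m}(P_{a,b,c})=\log\max\{|a|,|b|\}.$$
   Context: For a nonzero Laurent polynomial $P\in\mathbb{C}[x^{\pm1},y^{\pm1}]$, the (logarithmic) Mahler measure is $$\mathrm{m}(P)=\int_0^1\int_0^1\log|P(e^{2\pi i\theta_1},e^{2\pi i\theta_2})|\,\mathrm{d}\theta_1\,\mathrm{d}\theta_2 .$$ *)

theory Defs
  imports "HOL-Analysis.Analysis" "HOL-Library.Poly_Mapping"
begin

text \<open>
  The ring of complex Laurent polynomials in two variables is the monoid algebra of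
  \<open>\<int> \<times> \<int>\<close> over the complex numbers: the key \<open>(i, j)\<close> is the exponent vector of
  \<open>x\<^sup>i y\<^sup>j\<close>, and the ring operations are those of the type of finitely supported functions.
\<close>

type_synonym laurent2 = "(int \<times> int) \<Rightarrow>\<^sub>0 complex"

definition lconst :: "complex \<Rightarrow> laurent2" where
  "lconst z = Poly_Mapping.single (0, 0) z"

definition lX :: laurent2 where
  "lX = Poly_Mapping.single (1, 0) 1"

definition lXinv :: laurent2 where
  "lXinv = Poly_Mapping.single (-1, 0) 1"

definition lY :: laurent2 where
  "lY = Poly_Mapping.single (0, 1) 1"

definition lYinv :: laurent2 where
  "lYinv = Poly_Mapping.single (0, -1) 1"

lemma lX_inverse: "lX * lXinv = 1"
  by (simp add: lX_def lXinv_def mult_single flip: single_one zero_prod_def)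

lemma lY_inverse: "lY * lYinv = 1"
  by (simp add: lY_def lYinv_def mult_single flip: single_one zero_prod_def)

definition leval :: "laurent2 \<Rightarrow> complex \<Rightarrow> complex \<Rightarrow> complex" where
  "leval P x y =
     (\<Sum>k\<in>Poly_Mapping.keys P. Poly_Mapping.lookup P k * x powi fst k * y powi snd k)"

text \<open>
  The value is meaningful only for \<open>P \<noteq> 0\<close>. The convention \<open>ln 0 = 0\<close> is harmless there: the
  zeros of a nonzero Laurent polynomial on the torus form a null set.
\<close>

definition mahler_measure :: "laurent2 \<Rightarrow> real" where
  "mahler_measure P =
     (LBINT t2=0..1. (LBINT t1=0..1.
        ln (cmod (leval P (exp (2 * of_real pi * \<i> * of_real t1))
                          (exp (2 * of_real pi * \<i> * of_real t2))))))"

definition P_abc :: "real \<Rightarrow> real \<Rightarrow> real \<Rightarrow> laurent2" where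
  "P_abc a b c =
     lconst (of_real a) * (lX + lXinv) + lconst (of_real b) * (lY + lYinv) + lconst (of_real c)"

lemma leval_add: "leval (P + Q) x y = leval P x y + leval Q x y"
proof -
  let ?K = "Poly_Mapping.keys P \<union> Poly_Mapping.keys Q"
  let ?f = "\<lambda>R k. Poly_Mapping.lookup R k * x powi fst k * y powi snd k"
  have ext: "leval R x y = sum (?f R) ?K" if "Poly_Mapping.keys R \<subseteq> ?K" for R
    unfolding leval_def using that
    by (intro sum.mono_neutral_left) (auto simp: in_keys_iff)
  show ?thesis
    using ext[of P] ext[of Q] ext[of "P + Q"] keys_add[of P Q]
    by (simp add: lookup_add distrib_right sum.distrib)
qed

lemma leval_single: "leval (Poly_Mapping.single k z) x y = z * x powi fst k * y powi snd k"
  by (simp add: leval_def)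

lemma leval_P_abc:
  "leval (P_abc a b c) x y = of_real a * (x + 1 / x) + of_real b * (y + 1 / y) + of_real c"
  by (simp add: P_abc_def lconst_def lX_def lXinv_def lY_def lYinv_def distrib_left mult_single
      leval_add leval_single power_int_minus field_simps)

end

theory Submission
  imports Defs "HOL-Real_Asymp.Real_Asymp"
begin

text \<open>
  On the torus \<open>P\<close> takes the value \<open>2a cos(2\<pi>s) + 2b cos(2\<pi>t) + c\<close>. If \<open>\<bar>b\<bar> \<le> \<bar>a\<bar>\<close>, then for every
  \<open>t\<close> the number \<open>d = 2b cos(2\<pi>t) + c\<close> satisfies \<open>\<bar>d\<bar> \<le> 2\<bar>a\<bar>\<close>. Writing \<open>d = 2a cos(2\<pi>k)\<close>,
  the value factors as \<open>a\<close> times two translates of \<open>2 sin(\<pi>s)\<close>, and \<open>ln\<bar>2 sin(\<pi>s)\<bar>\<close> has mean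
  zero: by the duplication formula its integral \<open>I\<close> satisfies \<open>I = I + I\<close>. So already the inner
  integral equals \<open>ln\<bar>a\<bar>\<close>. If \<open>\<bar>a\<bar> < \<bar>b\<bar>\<close>, the same argument applies after exchanging the
  integrals.
\<close>

section \<open>Integration over one period\<close>

abbreviation has_unit_integral :: "(real \<Rightarrow> real) \<Rightarrow> real \<Rightarrow> bool" where
  "has_unit_integral f I \<equiv> has_bochner_integral lborel (\<lambda>u. indicator {0..<1} u *\<^sub>R f u) I"

text \<open>Replacing the open interval by a half-open one costs nothing and lets the pieces of a
  cut period fit together exactly, so the rearrangements below are pointwise identities.\<close>

lemma interval_integral_unit:
  fixes f :: "real \<Rightarrow> real"
  shows "(LBINT u=0..1. f u) = (\<integral>u. indicator {0..<1} u *\<^sub>R f u \<partial>lborel)"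
  using interval_integral_Ico[of 0 1 f]
  by (simp add: set_lebesgue_integral_def zero_ereal_def one_ereal_def)

lemma has_unit_integral_imp_interval:
  "has_unit_integral f I \<Longrightarrow> (LBINT u=0..1. f u) = I"
  unfolding interval_integral_unit by (rule has_bochner_integral_integral_eq)

lemma has_unit_integral_const: "has_unit_integral (\<lambda>u. k) k"
proof -
  have "has_bochner_integral lborel (indicator {0..<1::real} :: real \<Rightarrow> real) (measure lborel {0..<1::real})"
    by (rule has_bochner_integral_real_indicator) auto
  then show ?thesis
    using has_bochner_integral_mult_left[of k lborel "indicator {0..<1::real}" 1] by (auto simp: mult.commute)
qed

text \<open>The period is cut at \<open>c\<close>. The right piece moves left by \<open>c\<close>,
  the left piece moves right by \<open>1 - c\<close>, and periodicity identifies the result with the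
  translate of \<open>f\<close>.\<close>

lemma has_unit_integral_shift:
  fixes f :: "real \<Rightarrow> real"
  assumes f: "has_unit_integral f I" and per: "\<And>x. f (x + 1) = f x"
    and c: "0 \<le> c" "c \<le> 1"
  shows "has_unit_integral (\<lambda>u. f (u + c)) I"
proof -
  let ?g = "\<lambda>u. indicator {0..<1} u *\<^sub>R f u"
  let ?p = "\<lambda>u. indicator {c..<1} u *\<^sub>R f u" and ?q = "\<lambda>u. indicator {0..<c} u *\<^sub>R f u"
  have int: "set_integrable lborel {0..<1} f"
    using f by (simp add: set_integrable_def has_bochner_integral_iff)
  have "set_integrable lborel {c..<1} f" "set_integrable lborel {0..<c} f"
    using c by (auto intro!: set_integrable_subset[OF int])
  then obtain A B where A: "has_bochner_integral lborel ?p A" and B: "has_bochner_integral lborel ?q B"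
    by (auto simp: set_integrable_def integrable.simps)
  have "has_bochner_integral lborel (\<lambda>u. ?p u + ?q u) (A + B)"
    by (rule has_bochner_integral_add[OF A B])
  also have "(\<lambda>u. ?p u + ?q u) = ?g"
    using c by (auto simp: indicator_def fun_eq_iff)
  finally have AB: "A + B = I"
    using f has_bochner_integral_eq by blast
  have "has_bochner_integral lborel (\<lambda>u. ?p (c + 1 * u)) A"
    using A lborel_has_bochner_integral_real_affine_iff[of 1 ?p A c] by simp
  moreover have "has_bochner_integral lborel (\<lambda>u. ?q ((c - 1) + 1 * u)) B"
    using B lborel_has_bochner_integral_real_affine_iff[of 1 ?q B "c - 1"] by simp
  ultimately have "has_bochner_integral lborel (\<lambda>u. ?p (c + 1 * u) + ?q ((c - 1) + 1 * u)) (A + B)"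
    by (rule has_bochner_integral_add)
  also have "(\<lambda>u. ?p (c + 1 * u) + ?q ((c - 1) + 1 * u)) = (\<lambda>u. indicator {0..<1} u *\<^sub>R f (u + c))"
  proof
    fix u
    have "f (c - 1 + u) = f (u + c)"
      using per[of "c - 1 + u"] by (simp add: algebra_simps)
    then show "?p (c + 1 * u) + ?q ((c - 1) + 1 * u) = indicator {0..<1} u *\<^sub>R f (u + c)"
      using c by (auto simp: indicator_def add.commute)
  qed
  finally show ?thesis by (simp add: AB)
qed

text \<open>Two half-scale copies of the period, on \<open>{0..<1/2}\<close> and
  \<open>{1/2..<1}\<close>, contribute \<open>I / 2\<close> each.\<close>

lemma has_unit_integral_double:
  fixes f :: "real \<Rightarrow> real"
  assumes f: "has_unit_integral f I" and per: "\<And>x. f (x + 1) = f x"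
  shows "has_unit_integral (\<lambda>u. f (2 * u)) I"
proof -
  let ?g = "\<lambda>u. indicator {0..<1} u *\<^sub>R f u"
  have "has_bochner_integral lborel (\<lambda>u. ?g (0 + 2 * u)) (I / 2)"
    using f lborel_has_bochner_integral_real_affine_iff[of 2 ?g I 0] by simp
  moreover have "has_bochner_integral lborel (\<lambda>u. ?g (-1 + 2 * u)) (I / 2)"
    using f lborel_has_bochner_integral_real_affine_iff[of 2 ?g I "-1"] by simp
  ultimately have "has_bochner_integral lborel (\<lambda>u. ?g (0 + 2 * u) + ?g (-1 + 2 * u)) (I / 2 + I / 2)"
    by (rule has_bochner_integral_add)
  also have "(\<lambda>u. ?g (0 + 2 * u) + ?g (-1 + 2 * u)) = (\<lambda>u. indicator {0..<1} u *\<^sub>R f (2 * u))"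
  proof
    fix u
    show "?g (0 + 2 * u) + ?g (-1 + 2 * u) = indicator {0..<1} u *\<^sub>R f (2 * u)"
      using per[of "2 * u - 1"] by (auto simp: indicator_def)
  qed
  finally show ?thesis by simp
qed

section \<open>Integrability of the logarithmic sine\<close>

lemma sin_pi_ge:
  fixes u :: real
  assumes "0 \<le> u" "u \<le> 1"
  shows "2 * u * (1 - u) \<le> sin (pi * u)"
proof -
  \<comment> \<open>Concavity of the sine puts its graph above the chord from \<open>0\<close> to
    \<open>pi/2\<close>; the reflection of \<open>u\<close> to \<open>1 - u\<close> covers the other
    half.\<close>
  have conv: "convex_on {0..pi/2} (\<lambda>x. - sin x)"
    by (rule f''_ge0_imp_convex[where f' = "\<lambda>x. - cos x" and f'' = "\<lambda>x. sin x"])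
       (auto intro!: derivative_eq_intros sin_ge_zero)
  have half: "2 * v \<le> sin (pi * v)" if "0 \<le> v" "v \<le> 1/2" for v :: real
    using convex_onD[OF conv, of "2 * v" 0 "pi / 2"] that by (simp add: mult.commute)
  show ?thesis
  proof (cases "u \<le> 1/2")
    case True
    have "u * (1 - u) \<le> u" using assms by (simp add: mult_left_le)
    then show ?thesis using half[of u] assms True by simp
  next
    case False
    have "sin (pi * (1 - u)) = sin (pi * u)" by (simp add: right_diff_distrib)
    moreover have "u * (1 - u) \<le> 1 - u" using assms by (simp add: mult_left_le_one_le)
    ultimately show ?thesis using half[of "1 - u"] assms False by simp
  qed
qed

text \<open>The integrand is nonnegative and its antiderivative \<open>?F\<close> has finite limits
  at both singular ends. The term \<open>2 * u\<close> cancels the constants produced by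
  differentiating the other two.\<close>

lemma integrable_log_bound:
  "set_integrable lborel {0<..<1::real} (\<lambda>u. - ln u - ln (1 - u))"
proof -
  let ?F = "\<lambda>u::real. 2 * u - u * ln u + (1 - u) * ln (1 - u)"
  have "set_integrable lborel (einterval (ereal 0) (ereal 1)) (\<lambda>u::real. - ln u - ln (1 - u))"
  proof (rule interval_integral_FTC_nonneg(1)[where F = ?F and A = 0 and B = 2])
    show "((?F \<circ> real_of_ereal) \<longlongrightarrow> 0) (at_right (ereal 0))"
      unfolding ereal_tendsto_simps by real_asymp
    show "((?F \<circ> real_of_ereal) \<longlongrightarrow> 2) (at_left (ereal 1))"
      unfolding ereal_tendsto_simps by real_asymp
    show "AE x in lborel. ereal 0 < ereal x \<longrightarrow> ereal x < ereal 1 \<longrightarrow> 0 \<le> - ln x - ln (1 - x)"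
    proof (rule AE_I2, intro impI)
      fix x :: real
      assume "ereal 0 < ereal x" "ereal x < ereal 1"
      then have "ln x \<le> 0" "ln (1 - x) \<le> 0" by auto
      then show "0 \<le> - ln x - ln (1 - x)" by simp
    qed
    show "DERIV ?F x :> - ln x - ln (1 - x)" if "ereal 0 < ereal x" "ereal x < ereal 1" for x
      using that by (auto intro!: derivative_eq_intros)
  qed (auto intro!: continuous_intros)
  then show ?thesis by simp
qed

text \<open>Inside the interval the function lies between \<open>ln u + ln (1 - u)\<close>, by
  \<open>sin_pi_ge\<close>, and \<open>ln 2\<close>.\<close>

lemma integrable_ln_sin: "set_integrable lborel {0..<1::real} (\<lambda>u. ln \<bar>2 * sin (pi * u)\<bar>)"
proof -
  have "integrable lborel (\<lambda>u::real. indicator {0<..<1} u *\<^sub>R ln 2 + indicator {0<..<1} u *\<^sub>R (- ln u - ln (1 - u)))"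
    using integrable_log_bound unfolding set_integrable_def
    by (intro Bochner_Integration.integrable_add) (auto)
  then have "integrable lborel (\<lambda>u::real. indicator {0..<1} u *\<^sub>R ln \<bar>2 * sin (pi * u)\<bar>)"
  proof (rule Bochner_Integration.integrable_bound)
    show "AE u in lborel. norm (indicator {0..<1} u *\<^sub>R ln \<bar>2 * sin (pi * u)\<bar>)
      \<le> norm (indicator {0<..<1} u *\<^sub>R ln 2 + indicator {0<..<1} u *\<^sub>R (- ln u - ln (1 - u)))"
    proof (rule AE_I2)
      fix u :: real
      show "norm (indicator {0..<1} u *\<^sub>R ln \<bar>2 * sin (pi * u)\<bar>)
        \<le> norm (indicator {0<..<1} u *\<^sub>R ln 2 + indicator {0<..<1} u *\<^sub>R (- ln u - ln (1 - u)))"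
      proof (cases "0 < u \<and> u < 1")
        case True
        let ?s = "2 * sin (pi * u)"
        have pos: "0 < u * (1 - u)" using True by simp
        have low: "u * (1 - u) \<le> ?s" using sin_pi_ge[of u] True pos by linarith
        have "ln (u * (1 - u)) \<le> ln ?s" using low pos by simp
        moreover have "ln (u * (1 - u)) = ln u + ln (1 - u)" using True by (simp add: ln_mult)
        moreover have "ln ?s \<le> ln 2" using low pos by simp
        moreover have "0 \<le> ln (2::real)" "ln u \<le> 0" "ln (1 - u) \<le> 0" using True by auto
        ultimately have "\<bar>ln ?s\<bar> \<le> ln 2 + (- ln u - ln (1 - u))" by linarith
        moreover have "\<bar>?s\<bar> = ?s" using low pos by simp
        ultimately show ?thesis using True by simp
      next
        case False
        \<comment> \<open>At \<open>u = 0\<close> the left side vanishes because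
          \<open>ln 0 = 0\<close>.\<close>
        then show ?thesis by (auto simp: indicator_def)
      qed
    qed
  qed measurable
  then show ?thesis by (simp add: set_integrable_def)
qed

section \<open>Mean values of logarithms of trigonometric functions\<close>

lemma sin_pi_plus_one: "sin (pi * (x + 1)) = - sin (pi * x)"
  by (simp add: distrib_left)

text \<open>The range up to 2 accommodates both the doubled argument \<open>2 * u\<close> and the
  shifted arguments \<open>u + c\<close> for \<open>u\<close> in the unit interval.\<close>

lemma sin_pi_eq_0:
  assumes "sin (pi * x) = 0" "0 \<le> x" "x < 2"
  shows "x = 0 \<or> x = 1"
proof -
  obtain i :: int where "pi * x = of_int i * pi" using assms(1) by (auto simp: sin_zero_iff_int2)
  then have "x = of_int i" by simp
  with assms have "0 \<le> i" "i < 2" by auto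
  then have "i = 0 \<or> i = 1" by auto
  with \<open>x = of_int i\<close> show ?thesis by auto
qed

text \<open>With \<open>ln 0 = 0\<close> the logarithm law can fail where the product vanishes; a
  finite set of such points is negligible.\<close>

lemma has_unit_integral_add_ln:
  fixes f g h :: "real \<Rightarrow> real"
  assumes f: "has_unit_integral (\<lambda>u. ln \<bar>f u\<bar>) I" and g: "has_unit_integral (\<lambda>u. ln \<bar>g u\<bar>) J"
    and fin: "finite {u \<in> {0..<1}. f u * g u = 0}"
  shows "has_unit_integral (\<lambda>u. ln \<bar>f u * g u\<bar>) (I + J)"
proof -
  let ?X = "{u \<in> {0..<1}. f u * g u = 0}"
  have "has_bochner_integral lborel (\<lambda>u. indicator {0..<1} u *\<^sub>R ln \<bar>f u\<bar> + indicator {0..<1} u *\<^sub>R ln \<bar>g u\<bar>) (I + J)"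
    by (rule has_bochner_integral_add[OF f g])
  also have "?this \<longleftrightarrow> ?thesis"
  proof (rule has_bochner_integral_discrete_difference[where X = ?X])
    show "countable ?X" using fin by (rule countable_finite)
  qed (auto simp: indicator_def abs_mult ln_mult)
  finally show ?thesis .
qed

lemma has_unit_integral_ln_sin: "has_unit_integral (\<lambda>u. ln \<bar>2 * sin (pi * u)\<bar>) 0"
proof -
  let ?g = "\<lambda>u::real. 2 * sin (pi * u)"
  \<comment> \<open>Integrability comes first: cancelling in \<open>I + I = I\<close> needs a finite
    \<open>I\<close>.\<close>
  obtain I where I: "has_unit_integral (\<lambda>u. ln \<bar>?g u\<bar>) I"
    using integrable_ln_sin by (auto simp: set_integrable_def integrable.simps)
  \<comment> \<open>The sine changes sign under this shift; the absolute value makes the period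
    1.\<close>
  have per: "ln \<bar>?g (x + 1)\<bar> = ln \<bar>?g x\<bar>" for x by (simp only: sin_pi_plus_one) simp
  have prod: "?g u * ?g (u + 1/2) = ?g (2 * u)" for u
    using sin_double[of "pi * u"] by (simp add: distrib_left sin_add algebra_simps)
  have "{u \<in> {0..<1}. ?g u * ?g (u + 1/2) = 0} \<subseteq> {0, 1/2}"
  proof
    fix u assume u: "u \<in> {u \<in> {0..<1}. ?g u * ?g (u + 1/2) = 0}"
    then have "sin (pi * (2 * u)) = 0" unfolding prod by simp
    then show "u \<in> {0, 1/2}" using sin_pi_eq_0[of "2 * u"] u by auto
  qed
  then have fin: "finite {u \<in> {0..<1}. ?g u * ?g (u + 1/2) = 0}"
    by (rule finite_subset) simp
  have "has_unit_integral (\<lambda>u. ln \<bar>?g (2 * u)\<bar>) (I + I)"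
    using has_unit_integral_add_ln[OF I has_unit_integral_shift[OF I per, of "1/2"] fin]
    unfolding prod by simp
  then have "I + I = I"
    using has_unit_integral_double[OF I per] has_bochner_integral_eq by blast
  then show ?thesis using I by simp
qed

lemma has_unit_integral_ln_cos:
  fixes a d :: real
  assumes "a \<noteq> 0" and d: "\<bar>d\<bar> \<le> 2 * \<bar>a\<bar>"
  shows "has_unit_integral (\<lambda>u. ln \<bar>2 * a * cos (2 * pi * u) + d\<bar>) (ln \<bar>a\<bar>)"
proof -
  let ?g = "\<lambda>u::real. 2 * sin (pi * u)"
  \<comment> \<open>This choice gives \<open>d = 2 * a * cos (2 * pi * k)\<close>, with
    \<open>k\<close> at most \<open>1/2\<close>, so both shifts \<open>1/2 + k\<close> and
    \<open>1/2 - k\<close> lie in the unit interval.\<close>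
  define k where "k = arccos (d / (2 * a)) / (2 * pi)"
  have "\<bar>d / (2 * a)\<bar> \<le> 1" using assms by (simp add: abs_mult)
  then have da: "- 1 \<le> d / (2 * a)" "d / (2 * a) \<le> 1" by linarith+
  have k: "0 \<le> k" "k \<le> 1/2" 
    using arccos_lbound[OF da] arccos_ubound[OF da] by (auto simp: k_def field_simps)
  have cosk: "cos (2 * pi * k) = d / (2 * a)"
    using da by (simp add: k_def)
  \<comment> \<open>Product-to-sum formula; the two halves in the shifts add up to
    \<open>pi\<close>, which turns the minus sign before the second cosine into a plus.\<close>
  have prod: "?g (u + (1/2 + k)) * ?g (u + (1/2 - k)) * a = 2 * a * cos (2 * pi * u) + d" for u
  proof -
    have "pi * (u + (1/2 + k)) - pi * (u + (1/2 - k)) = 2 * pi * k"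
      by (simp add: algebra_simps)
    moreover have "pi * (u + (1/2 + k)) + pi * (u + (1/2 - k)) = 2 * pi * u + pi"
      by (simp add: algebra_simps)
    ultimately have "sin (pi * (u + (1/2 + k))) * sin (pi * (u + (1/2 - k))) = (d / (2 * a) + cos (2 * pi * u)) / 2"
      unfolding sin_times_sin using cosk by simp
    then show ?thesis using \<open>a \<noteq> 0\<close> by (simp add: field_simps)
  qed
  have sh: "has_unit_integral (\<lambda>u. ln \<bar>?g (u + c)\<bar>) 0" if "0 \<le> c" "c \<le> 1" for c
    by (rule has_unit_integral_shift[OF has_unit_integral_ln_sin _ that])
       (simp only: sin_pi_plus_one, simp)
  have z: "u \<in> {-c, 1-c}" if "?g (u + c) = 0" "0 \<le> c" "c \<le> 1" "u \<in> {0..<1}" for u c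
    using sin_pi_eq_0[of "u + c"] that by auto
  have fin: "finite {u \<in> {0..<1}. ?g (u + (1/2 + k)) * ?g (u + (1/2 - k)) = 0}"
    by (rule finite_subset[where B = "{-(1/2+k), 1-(1/2+k), -(1/2-k), 1-(1/2-k)}"])
       (use z[of _ "1/2 + k"] z[of _ "1/2 - k"] k in \<open>auto simp del: mult_eq_0_iff simp: mult_eq_0_iff[of "?g _" "?g _"]\<close>)
  have 1: "has_unit_integral (\<lambda>u. ln \<bar>?g (u + (1/2 + k)) * ?g (u + (1/2 - k))\<bar>) (0 + 0)"
    by (rule has_unit_integral_add_ln[OF sh sh fin]) (use k in auto)
  \<comment> \<open>The constant \<open>a\<close> enters as a third factor and supplies the whole
    mean value.\<close>
  have "has_unit_integral (\<lambda>u. ln \<bar>?g (u + (1/2 + k)) * ?g (u + (1/2 - k)) * a\<bar>) (0 + 0 + ln \<bar>a\<bar>)"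
    by (rule has_unit_integral_add_ln[OF 1 has_unit_integral_const])
       (use fin \<open>a \<noteq> 0\<close> in simp)
  then show ?thesis unfolding prod by simp
qed

section \<open>Values on the torus and exchange of the integrals\<close>

lemma leval_P_abc_torus:
  "cmod (leval (P_abc a b c) (exp (2 * of_real pi * \<i> * of_real s)) (exp (2 * of_real pi * \<i> * of_real t)))
     = \<bar>2 * a * cos (2 * pi * s) + 2 * b * cos (2 * pi * t) + c\<bar>"
proof -
  have cis: "exp (2 * of_real pi * \<i> * of_real u) + 1 / exp (2 * of_real pi * \<i> * of_real u)
      = of_real (2 * cos (2 * pi * u))" for u
  proof -
    have "exp (2 * of_real pi * \<i> * of_real u) = cis (2 * pi * u)"
      by (simp add: cis_conv_exp algebra_simps)
    then show ?thesis by (simp add: complex_eq_iff divide_inverse cis_inverse)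
  qed
  have "leval (P_abc a b c) (exp (2 * of_real pi * \<i> * of_real s)) (exp (2 * of_real pi * \<i> * of_real t))
      = of_real (2 * a * cos (2 * pi * s) + 2 * b * cos (2 * pi * t) + c)"
    unfolding leval_P_abc cis by simp
  then show ?thesis by (simp only: norm_of_real)
qed

lemma abs_cos_add_le: "\<bar>2 * x * cos y + c\<bar> \<le> 2 * \<bar>x\<bar> + \<bar>c\<bar>" for x y c :: real
proof -
  have "\<bar>2 * x * cos y\<bar> \<le> 2 * \<bar>x\<bar>"
    using mult_left_le[OF abs_cos_le_one[of y], of "2 * \<bar>x\<bar>"] by (simp add: abs_mult)
  then show ?thesis
    using abs_triangle_ineq[of "2 * x * cos y" c] by linarith
qed

text \<open>
  Turns the value of the integral of \<open>ln z\<close> into a uniform bound for that of \<open>\<bar>ln z\<bar>\<close>, which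
  Fubini's theorem needs. The case \<open>z = 0\<close> relies on \<open>ln 0 = 0\<close>.
\<close>

lemma abs_ln_le:
  fixes z M :: real
  assumes "0 \<le> z" "z \<le> M" "1 \<le> M"
  shows "\<bar>ln z\<bar> \<le> 2 * ln M - ln z"
proof -
  have "ln z \<le> ln M" "0 \<le> ln M" using assms by (auto simp: ln_le_cancel_iff le_less)
  then show ?thesis by linarith
qed

text \<open>For fixed \<open>s\<close> the integral over \<open>t\<close> is known from
  \<open>has_unit_integral_ln_cos\<close>, since \<open>b\<close> dominates. Fubini's theorem
  transfers this to the given order.\<close>

lemma iterated_integral_ln_cos_swap:
  fixes a b c :: real
  assumes "b \<noteq> 0" and bound: "\<bar>c\<bar> \<le> 2 * (\<bar>b\<bar> - \<bar>a\<bar>)"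
  shows "(LBINT t=0..1. (LBINT s=0..1. ln \<bar>2 * a * cos (2 * pi * s) + 2 * b * cos (2 * pi * t) + c\<bar>)) = ln \<bar>b\<bar>"
proof -
  define F where "F s t = ln \<bar>2 * a * cos (2 * pi * s) + 2 * b * cos (2 * pi * t) + c\<bar>" for s t
  define h where "h s t = indicator {0..<1} s *\<^sub>R (indicator {0..<1} t *\<^sub>R F s t)" for s t :: real
  \<comment> \<open>The summand 1 secures \<open>1 \<le> M\<close> for
    \<open>abs_ln_le\<close>.\<close>
  define M where "M = 1 + 2 * \<bar>a\<bar> + 2 * \<bar>b\<bar> + \<bar>c\<bar>"
  have F: "has_unit_integral (F s) (ln \<bar>b\<bar>)" for s
  proof -
    have "\<bar>2 * a * cos (2 * pi * s) + c\<bar> \<le> 2 * \<bar>a\<bar> + \<bar>c\<bar>"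
      by (rule abs_cos_add_le)
    also have "\<dots> \<le> 2 * \<bar>b\<bar>"
      using bound by simp
    finally have "\<bar>2 * a * cos (2 * pi * s) + c\<bar> \<le> 2 * \<bar>b\<bar>" .
    from has_unit_integral_ln_cos[OF \<open>b \<noteq> 0\<close> this] show ?thesis
      by (simp add: F_def[abs_def] algebra_simps)
  qed
  have Fabs: "\<bar>F s t\<bar> \<le> 2 * ln M - F s t" for s t
    unfolding F_def
  proof (rule abs_ln_le)
    have "\<bar>2 * a * cos (2 * pi * s) + (2 * b * cos (2 * pi * t) + c)\<bar>
        \<le> 2 * \<bar>a\<bar> + \<bar>2 * b * cos (2 * pi * t) + c\<bar>"
      by (rule abs_cos_add_le)
    also have "\<dots> \<le> 2 * \<bar>a\<bar> + (2 * \<bar>b\<bar> + \<bar>c\<bar>)"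
      by (intro add_left_mono abs_cos_add_le)
    finally show "\<bar>2 * a * cos (2 * pi * s) + 2 * b * cos (2 * pi * t) + c\<bar> \<le> M"
      by (simp add: M_def add.assoc)
  qed (simp_all add: M_def)
  have hs: "has_bochner_integral lborel (h s) (indicator {0..<1} s *\<^sub>R ln \<bar>b\<bar>)" for s
    unfolding h_def[abs_def] by (rule has_bochner_integral_scaleR_right) (rule F)
  \<comment> \<open>Integrating \<open>Fabs\<close> over \<open>t\<close> bounds the absolute
    integral independently of \<open>s\<close>.\<close>
  have bnd: "(\<integral>t. norm (h s t) \<partial>lborel) \<le> 2 * ln M - ln \<bar>b\<bar>" if "s \<in> {0..<1}" for s
  proof -
    have "has_bochner_integral lborel
        (\<lambda>t. indicator {0..<1} t *\<^sub>R (2 * ln M) - indicator {0..<1} t *\<^sub>R F s t) (2 * ln M - ln \<bar>b\<bar>)"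
      by (rule has_bochner_integral_diff[OF has_unit_integral_const F])
    then have I: "integrable lborel (\<lambda>t. indicator {0..<1} t *\<^sub>R (2 * ln M) - indicator {0..<1} t *\<^sub>R F s t)"
      and E: "(\<integral>t. indicator {0..<1} t *\<^sub>R (2 * ln M) - indicator {0..<1} t *\<^sub>R F s t \<partial>lborel) = 2 * ln M - ln \<bar>b\<bar>"
      by (auto simp: has_bochner_integral_iff)
    show ?thesis unfolding E[symmetric]
    proof (rule integral_mono[OF _ I])
      show "integrable lborel (\<lambda>t. norm (h s t))"
        using hs[of s] by (simp add: has_bochner_integral_iff)
      show "norm (h s t) \<le> indicator {0..<1} t *\<^sub>R (2 * ln M) - indicator {0..<1} t *\<^sub>R F s t" for t
        using that Fabs[of s t] by (simp add: h_def indicator_def)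
    qed
  qed
  have [measurable]: "case_prod h \<in> borel_measurable (lborel \<Otimes>\<^sub>M lborel)"
    unfolding h_def F_def by measurable
  \<comment> \<open>Joint integrability: the integrals of the norm over \<open>t\<close> are bounded
    on the unit interval and zero outside it.\<close>
  have "integrable (lborel \<Otimes>\<^sub>M lborel) (case_prod h)"
  proof (rule lborel_pair.Fubini_integrable)
    show "AE s in lborel. integrable lborel (\<lambda>t. case_prod h (s, t))"
      using hs by (simp add: has_bochner_integral_iff)
    show "integrable lborel (\<lambda>s. \<integral>t. norm (case_prod h (s, t)) \<partial>lborel)"
    proof (rule integrableI_bounded_set[where A = "{0..<1}" and B = "2 * ln M - ln \<bar>b\<bar>"])
      show "AE s in lborel. s \<in> {0..<1} \<longrightarrow> norm (\<integral>t. norm (case_prod h (s, t)) \<partial>lborel) \<le> 2 * ln M - ln \<bar>b\<bar>"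
        using bnd by simp
      show "AE s in lborel. s \<notin> {0..<1} \<longrightarrow> (\<integral>t. norm (case_prod h (s, t)) \<partial>lborel) = 0"
        by (simp add: h_def)
    qed auto
  qed measurable
  then have "(\<integral>t. (\<integral>s. h s t \<partial>lborel) \<partial>lborel) = (\<integral>s. (\<integral>t. h s t \<partial>lborel) \<partial>lborel)"
    by (rule lborel_pair.Fubini_integral)
  also have "\<dots> = (\<integral>s. indicator {0..<1::real} s *\<^sub>R ln \<bar>b\<bar> \<partial>lborel)"
    by (simp only: has_bochner_integral_integral_eq[OF hs])
  also have "\<dots> = ln \<bar>b\<bar>"
    by (rule has_bochner_integral_integral_eq[OF has_unit_integral_const])
  finally have "(\<integral>t. (\<integral>s. h s t \<partial>lborel) \<partial>lborel) = ln \<bar>b\<bar>" .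
  moreover have "(LBINT t=0..1. (LBINT s=0..1. F s t)) = (\<integral>t. (\<integral>s. h s t \<partial>lborel) \<partial>lborel)"
  proof -
    have "(\<integral>s. h s t \<partial>lborel) = indicator {0..<1} t * (\<integral>s. indicator {0..<1} s * F s t \<partial>lborel)" for t
      unfolding h_def integral_mult_right_zero[symmetric] by (simp add: mult.left_commute)
    then show ?thesis by (simp add: interval_integral_unit)
  qed
  ultimately show ?thesis by (simp add: F_def)
qed

theorem theorem1:
  fixes a b c :: real
  assumes "(a, b) \<noteq> (0, 0)"
    and "\<bar>c\<bar> \<le> 2 * \<bar>\<bar>a\<bar> - \<bar>b\<bar>\<bar>"
  shows "mahler_measure (P_abc a b c) = ln (max \<bar>a\<bar> \<bar>b\<bar>)"
proof (cases "\<bar>b\<bar> \<le> \<bar>a\<bar>")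
  case True
  then have "a \<noteq> 0" using assms(1) by auto
  have inner: "(LBINT s=0..1. ln \<bar>2 * a * cos (2 * pi * s) + 2 * b * cos (2 * pi * t) + c\<bar>) = ln \<bar>a\<bar>" for t
  proof -
    have "\<bar>2 * b * cos (2 * pi * t) + c\<bar> \<le> 2 * \<bar>b\<bar> + \<bar>c\<bar>"
      by (rule abs_cos_add_le)
    also have "\<dots> \<le> 2 * \<bar>a\<bar>"
      \<comment> \<open>In this case the hypothesis reads
        \<open>\<bar>c\<bar> \<le> 2 * (\<bar>a\<bar> - \<bar>b\<bar>)\<close>.\<close>
      using assms(2) True by simp
    finally have "\<bar>2 * b * cos (2 * pi * t) + c\<bar> \<le> 2 * \<bar>a\<bar>" .
    from has_unit_integral_imp_interval[OF has_unit_integral_ln_cos[OF \<open>a \<noteq> 0\<close> this]]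
    show ?thesis by (simp add: add.assoc)
  qed
  show ?thesis
    unfolding mahler_measure_def leval_P_abc_torus inner
    using has_unit_integral_imp_interval[OF has_unit_integral_const] True by (simp add: max_def)
next
  case False
  then have "b \<noteq> 0" "\<bar>c\<bar> \<le> 2 * (\<bar>b\<bar> - \<bar>a\<bar>)" using assms(2) by auto
  then show ?thesis
    unfolding mahler_measure_def leval_P_abc_torus
    using iterated_integral_ln_cos_swap False by (simp add: max_def)
qed

end
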